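(* Let $K$ be a field, let $L$ be a GCB matrix of size $s\times s$, let $G_L$ be the underlying digraph of $L$ and let $I=I(L^\top)\subset S=K[t_1,\ldots,t_s]$ be the matrix ideal of $L^\top$. The following conditions are equivalent. (a) $G_L$ is strongly connected. (b) $V(I,t_i)=\{0\}$ for all $i$. (c) $L_{i,j}>0$ for all $i,j$, where ${\rm adj}(L)=(L_{i,j})$ is the adjoint of $L$.
   Context: An $s\times s$ integer matrix $L$ is a GCB (generalized critical binomial) matrix if its diagonal entries are $a_{1,1},\ldots,a_{s,s}>0$, its off-diagonal entries are $-a_{i,j}$ with $a_{i,j}\in\mathbb{N}=\{0,1,\ldots\}$, each column has at least one non-zero off-diagonal entry, and there exists a vector $\mathbf{b}$ of $s$ positive integers with $L\mathbf{b}^\top=0$. The matrix ideal $I(M)$ of an integer matrix $M$ with $s$ rows is the ideal of $S$ generated by the binomials $t^{a^+}-t^{a^-}$ where $a=a^+-a^-$ runs over the columns of $M$ and $a^\pm\in\mathbb{N}^s$ have disjoint support; thus $I(L^\top)$ is generated by the binomials defined by the rows of $L$. The underlying digraph of $L$ has vertex set $\{t_1,\ldots,t_s\}$ with an arc from $t_i$ to $t_j$ if and only if the $(i,j)$ entry of $L$ is non-zero (loops allowed). A digraph is strongly connected if any two vertices can be joined by a directed path (from any vertex to any other vertex). $V(\cdot)$ is the set of common zeros in $K^s$ and $V(I,t_i)=V((I,t_i))$. The adjoint is the classical adjugate: $L_{i,j}=(-1)^{i+j}h_{j,i}$ where $h_{j,i}$ is the determinant of the matrix obtained from $L$ by deleting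 row $j$ and column $i$. *)

theory Defs
  imports
    "HOL-Library.Poly_Mapping"
    "HOL-Algebra.Ideal"
    "Jordan_Normal_Form.Determinant"
    "Graph_Theory.Digraph_Component"
begin

text \<open>Indices run over \<open>0, \<dots>, s - 1\<close> instead of \<open>1, \<dots>, s\<close>; the parity of \<open>i + j\<close>,
  hence the sign of a cofactor, is not affected.\<close>

definition gcb_matrix :: "nat \<Rightarrow> int mat \<Rightarrow> bool" where
  "gcb_matrix s L \<longleftrightarrow>
     L \<in> carrier_mat s s \<and>
     (\<forall>i<s. L $$ (i, i) > 0) \<and>
     (\<forall>i<s. \<forall>j<s. i \<noteq> j \<longrightarrow> L $$ (i, j) \<le> 0) \<and>
     (\<forall>j<s. \<exists>i<s. i \<noteq> j \<and> L $$ (i, j) \<noteq> 0) \<and>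
     (\<exists>b \<in> carrier_vec s. (\<forall>i<s. b $ i > 0) \<and> L *\<^sub>v b = 0\<^sub>v s)"

text \<open>The vertex \<open>t\<^sub>i\<close> is represented by its index \<open>i\<close>.\<close>

definition underlying_digraph :: "int mat \<Rightarrow> nat pair_pre_digraph" where
  "underlying_digraph L =
     \<lparr> pverts = {..<dim_row L},
       parcs = {(i, j). i < dim_row L \<and> j < dim_col L \<and> L $$ (i, j) \<noteq> 0} \<rparr>"

text \<open>A polynomial maps exponent vectors (finitely supported functions on the indices of the
  variables) to coefficients. The type has infinitely many variables; the ring
  \<open>K[t\<^sub>0, \<dots>, t\<^sub>s\<^sub>-\<^sub>1]\<close> consists of the polynomials involving only the first \<open>s\<close> of them.\<close>

type_synonym 'k mvpoly = "(nat \<Rightarrow>\<^sub>0 nat) \<Rightarrow>\<^sub>0 'k"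

definition poly_ring :: "nat \<Rightarrow> 'k::field mvpoly ring" where
  "poly_ring s =
     \<lparr> carrier = {f. \<forall>m \<in> Poly_Mapping.keys f. Poly_Mapping.keys m \<subseteq> {..<s}},
       monoid.mult = (*), one = 1, zero = 0, add = (+) \<rparr>"

definition poly_var :: "nat \<Rightarrow> 'k::field mvpoly" where
  "poly_var i = Poly_Mapping.single (Poly_Mapping.single i 1) 1"

definition poly_eval :: "'k::field vec \<Rightarrow> 'k mvpoly \<Rightarrow> 'k" where
  "poly_eval x f = (\<Sum>m \<in> Poly_Mapping.keys f.
     Poly_Mapping.lookup f m * (\<Prod>i \<in> Poly_Mapping.keys m. (x $ i) ^ Poly_Mapping.lookup m i))"

text \<open>The conversion \<^const>\<open>nat\<close> sends negative integers to \<open>0\<close>, so the exponents below are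
  the entries of \<open>a\<^sup>+\<close> and \<open>a\<^sup>-\<close>.\<close>

definition vec_binomial :: "int vec \<Rightarrow> 'k::field mvpoly" where
  "vec_binomial a =
     (\<Prod>i<dim_vec a. poly_var i ^ nat (a $ i)) - (\<Prod>i<dim_vec a. poly_var i ^ nat (- (a $ i)))"

definition matrix_ideal :: "int mat \<Rightarrow> 'k::field mvpoly set" where
  "matrix_ideal M = Idl\<^bsub>poly_ring (dim_row M)\<^esub> (vec_binomial ` set (cols M))"

definition zero_locus :: "nat \<Rightarrow> 'k::field mvpoly set \<Rightarrow> 'k vec set" where
  "zero_locus s F = {x \<in> carrier_vec s. \<forall>f \<in> F. poly_eval x f = 0}"

lemma poly_ring_is_cring: "cring (poly_ring s :: 'k::field mvpoly ring)"
proof -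
  define C where "C = {f :: 'k mvpoly. \<forall>m \<in> Poly_Mapping.keys f. Poly_Mapping.keys m \<subseteq> {..<s}}"
  have R: "poly_ring s = \<lparr> carrier = C, monoid.mult = (*), one = 1, zero = 0, add = (+) \<rparr>"
    by (simp add: poly_ring_def C_def)
  have zero: "0 \<in> C" and one: "1 \<in> C"
    by (auto simp: C_def)
  have add: "f + g \<in> C" if "f \<in> C" "g \<in> C" for f g
    using that Poly_Mapping.keys_add[of f g] unfolding C_def by blast
  have mult: "f * g \<in> C" if fg: "f \<in> C" "g \<in> C" for f g
    unfolding C_def
  proof (clarify)
    fix m i assume "m \<in> Poly_Mapping.keys (f * g)" and i: "i \<in> Poly_Mapping.keys m"
    then obtain a b where ab: "a \<in> Poly_Mapping.keys f" "b \<in> Poly_Mapping.keys g" "m = a + b"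
      using keys_mult[of f g] by blast
    moreover have "i \<in> Poly_Mapping.keys a \<union> Poly_Mapping.keys b"
      using i Poly_Mapping.keys_add[of a b] ab(3) by blast
    ultimately show "i < s" using fg unfolding C_def by blast
  qed
  have neg: "\<exists>g \<in> C. f + g = 0" if "f \<in> C" for f
    using that by (intro bexI[of _ "- f"]) (auto simp: C_def)
  show ?thesis unfolding R
    by (intro cringI abelian_groupI comm_monoidI)
      (simp_all add: zero one add mult neg algebra_simps)
qed

lemma poly_var_in_poly_ring: "i < s \<Longrightarrow> poly_var i \<in> carrier (poly_ring s)"
  by (simp add: poly_ring_def poly_var_def)

end

theory Submission
  imports Defs "Jordan_Normal_Form.Char_Poly"
begin

text \<open>All three conditions are compared with irreducibility of \<open>L\<close>: no proper nonempty set of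
  indices is closed under predecessors in the digraph. The zero pattern of a point of
  \<open>V(I, t\<^sub>i)\<close> is closed under predecessors, and conversely a minimal proper closed set is the
  zero pattern of a \<open>0\<close>-\<open>1\<close> point. For the adjugate, \<open>det L = 0\<close> makes the entry of \<open>adj L\<close> at
  \<open>(r, r)\<close> the determinant of \<open>L\<close> with \<open>1\<close> added at \<open>(r, r)\<close>. If \<open>L\<close> is irreducible,
  a maximum principle shows that this matrix plus any nonnegative multiple of the identity is
  nonsingular, so its determinant is positive because the characteristic polynomial is monic, and
  the columns of \<open>adj L\<close> are multiples of \<open>b\<close>. If \<open>Z\<close> is a proper closed set, let \<open>u\<close>
  be the restriction of \<open>b\<close> to \<open>Z\<close>. Then \<open>L u \<ge> 0\<close>, and a positive row \<open>c\<close> of \<open>adj L\<close>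
  would give \<open>c L u = 0\<close>, hence \<open>L u = 0\<close>, and the diagonal entry of \<open>adj L\<close> at any index
  outside \<open>Z\<close> would vanish.\<close>

section \<open>Irreducibility and strong connectivity\<close>

text \<open>For square matrices this is the usual notion: a proper nonempty \<open>Z\<close>
  violating it is a block-triangular form under a simultaneous permutation of rows and
  columns.\<close>

definition irreducible_mat :: "nat \<Rightarrow> 'a::zero mat \<Rightarrow> bool" where
  "irreducible_mat n A \<longleftrightarrow>
     (\<forall>Z \<subseteq> {..<n}. Z \<noteq> {} \<longrightarrow> (\<forall>k<n. \<forall>j\<in>Z. A $$ (k, j) \<noteq> 0 \<longrightarrow> k \<in> Z) \<longrightarrow> Z = {..<n})"

lemma irreducible_matD:
  assumes "irreducible_mat n A" "Z \<subseteq> {..<n}" "Z \<noteq> {}"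
    "\<And>k j. k < n \<Longrightarrow> j \<in> Z \<Longrightarrow> A $$ (k, j) \<noteq> 0 \<Longrightarrow> k \<in> Z"
  shows "Z = {..<n}"
  using assms unfolding irreducible_mat_def by blast

lemma not_irreducible_matE:
  assumes "\<not> irreducible_mat n A"
  obtains Z where "Z \<subset> {..<n}" "Z \<noteq> {}"
    "\<And>k j. k < n \<Longrightarrow> j \<in> Z \<Longrightarrow> A $$ (k, j) \<noteq> 0 \<Longrightarrow> k \<in> Z"
  using assms unfolding irreducible_mat_def by blast

text \<open>The vertices from which \<open>v\<close> is reachable form a predecessor-closed set;
  conversely such a set contains every vertex that reaches one of its elements. \<open>n > 0\<close>
  because \<open>strongly_connected\<close> demands a vertex.\<close>

lemma strongly_connected_iff_irreducible_mat:
  assumes L: "L \<in> carrier_mat n n" and n: "n > 0"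
  shows "strongly_connected (with_proj (underlying_digraph L)) \<longleftrightarrow> irreducible_mat n L"
proof -
  define G where "G = with_proj (underlying_digraph L)"
  have verts: "verts G = {..<n}"
    using L by (simp add: G_def underlying_digraph_def)
  have arc: "(i, j) \<in> arcs_ends G \<longleftrightarrow> i < n \<and> j < n \<and> L $$ (i, j) \<noteq> 0" for i j
    using L by (simp add: G_def underlying_digraph_def)
  interpret wf_digraph G
    using L by unfold_locales (auto simp: G_def underlying_digraph_def)
  have "strongly_connected G" if irr: "irreducible_mat n L"
  proof (rule strongly_connectedI)
    show "verts G \<noteq> {}" using verts n by auto
    fix u v assume uv: "u \<in> verts G" "v \<in> verts G"
    have "{k. k < n \<and> k \<rightarrow>\<^sup>*\<^bsub>G\<^esub> v} = {..<n}"
    proof (rule irreducible_matD[OF irr])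
      show "{k. k < n \<and> k \<rightarrow>\<^sup>*\<^bsub>G\<^esub> v} \<noteq> {}"
        using uv verts by (auto intro!: exI[of _ v])
      fix k j assume "k < n" "j \<in> {k. k < n \<and> k \<rightarrow>\<^sup>*\<^bsub>G\<^esub> v}" "L $$ (k, j) \<noteq> 0"
      then show "k \<in> {k. k < n \<and> k \<rightarrow>\<^sup>*\<^bsub>G\<^esub> v}"
        using arc by (auto intro: adj_reachable_trans)
    qed auto
    with uv verts show "u \<rightarrow>\<^sup>*\<^bsub>G\<^esub> v" by blast
  qed
  moreover have "irreducible_mat n L" if sc: "strongly_connected G"
    unfolding irreducible_mat_def
  proof (intro allI impI)
    fix Z assume Z: "Z \<subseteq> {..<n}" "Z \<noteq> {}"
      and closed: "\<forall>k<n. \<forall>j\<in>Z. L $$ (k, j) \<noteq> 0 \<longrightarrow> k \<in> Z"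
    from Z obtain v where v: "v \<in> Z" "v < n" by auto
    have "u \<in> Z" if "u \<rightarrow>\<^sup>*\<^bsub>G\<^esub> v" for u
      using that by (induction rule: converse_reachable_induct) (use v closed arc in auto)
    moreover have "u \<rightarrow>\<^sup>*\<^bsub>G\<^esub> v" if "u < n" for u
      using sc that v verts by (auto simp: strongly_connected_def)
    ultimately show "Z = {..<n}" using Z by auto
  qed
  ultimately show ?thesis unfolding G_def by blast
qed

section \<open>Kernels and determinants of irreducible Z-matrices\<close>

lemma mult_mat_vec_index:
  assumes "A \<in> carrier_mat n m" "v \<in> carrier_vec m" "i < n"
  shows "(A *\<^sub>v v) $ i = (\<Sum>j<m. A $$ (i, j) * v $ j)"
  using assms by (simp add: scalar_prod_def atLeast0LessThan)

lemma mult_mat_vec_eq_0_iff: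
  assumes "A \<in> carrier_mat n m" "v \<in> carrier_vec m"
  shows "A *\<^sub>v v = 0\<^sub>v n \<longleftrightarrow> (\<forall>i<n. (\<Sum>j<m. A $$ (i, j) * v $ j) = 0)"
  using assms by (auto simp: vec_eq_iff mult_mat_vec_index[OF assms] simp del: index_mult_mat_vec)

text \<open>Maximum principle: the indices maximising \<open>\<bar>v $ i\<bar> / b i\<close> form a set closed under
  successors, on which the row sums weighted by \<open>b\<close> vanish.\<close>

lemma Z_matrix_kernel_trivial:
  fixes A :: "real mat" and b :: "nat \<Rightarrow> real"
  assumes A: "A \<in> carrier_mat n n"
    and off: "\<And>i j. i < n \<Longrightarrow> j < n \<Longrightarrow> i \<noteq> j \<Longrightarrow> A $$ (i, j) \<le> 0"
    and b: "\<And>i. i < n \<Longrightarrow> b i > 0"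
    and Ab: "\<And>i. i < n \<Longrightarrow> (\<Sum>j<n. A $$ (i, j) * b j) \<ge> 0"
    and r: "r < n" "(\<Sum>j<n. A $$ (r, j) * b j) > 0"
    and irr: "irreducible_mat n A"
    and v: "v \<in> carrier_vec n" "A *\<^sub>v v = 0\<^sub>v n"
  shows "v = 0\<^sub>v n"
proof (rule ccontr)
  assume "v \<noteq> 0\<^sub>v n"
  then obtain i0 where i0: "i0 < n" "v $ i0 \<noteq> 0" using v(1) by (auto simp: vec_eq_iff)
  define m where "m = Max ((\<lambda>i. \<bar>v $ i\<bar> / b i) ` {..<n})"
  have m_ge: "\<bar>v $ i\<bar> / b i \<le> m" if "i < n" for i
    unfolding m_def using that by (intro Max_ge) auto
  have bound: "\<bar>v $ i\<bar> \<le> m * b i" if "i < n" for i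
    using m_ge[OF that] b[OF that] by (simp add: field_simps)
  have m_pos: "m > 0"
    using m_ge[OF i0(1)] i0 b[OF i0(1)]
    by (meson divide_pos_pos less_le_trans zero_less_abs_iff)
  have "m \<in> (\<lambda>i. \<bar>v $ i\<bar> / b i) ` {..<n}"
    unfolding m_def using i0(1) by (intro Max_in) auto
  then obtain k0 where k0: "k0 < n" "\<bar>v $ k0\<bar> = m * b k0"
    using b by (fastforce simp: field_simps)
  define T where "T = {i. i < n \<and> \<bar>v $ i\<bar> = m * b i}"
  have key: "(\<Sum>j<n. A $$ (k, j) * b j) = 0 \<and> (\<forall>j<n. A $$ (k, j) \<noteq> 0 \<longrightarrow> j \<in> T)"
    if k: "k \<in> T" for k
  proof -
    have kn: "k < n" and vk: "\<bar>v $ k\<bar> = m * b k" using k by (auto simp: T_def)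
    let ?J = "{..<n} - {k}"
    have split: "(\<Sum>j<n. f j) = f k + (\<Sum>j\<in>?J. f j)" for f :: "nat \<Rightarrow> real"
      using kn by (simp add: sum.remove)
    have "(\<Sum>j<n. A $$ (k, j) * v $ j) = 0"
      using v A kn by (simp add: mult_mat_vec_eq_0_iff)
    then have "A $$ (k, k) * v $ k = - (\<Sum>j\<in>?J. A $$ (k, j) * v $ j)"
      by (simp add: split)
    then have "\<bar>A $$ (k, k) * v $ k\<bar> = \<bar>\<Sum>j\<in>?J. A $$ (k, j) * v $ j\<bar>" by simp
    also have "\<dots> \<le> (\<Sum>j\<in>?J. \<bar>A $$ (k, j) * v $ j\<bar>)" by (rule sum_abs)
    also have "\<dots> = (\<Sum>j\<in>?J. - A $$ (k, j) * \<bar>v $ j\<bar>)"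
      using off kn by (intro sum.cong) (auto simp: abs_mult abs_of_nonpos)
    finally have "\<bar>A $$ (k, k)\<bar> * (m * b k) \<le> (\<Sum>j\<in>?J. - A $$ (k, j) * \<bar>v $ j\<bar>)"
      by (simp only: abs_mult vk)
    \<comment> \<open>No sign is known for the diagonal entry, so the bound passes through its
      absolute value.\<close>
    moreover have "A $$ (k, k) * (m * b k) \<le> \<bar>A $$ (k, k)\<bar> * (m * b k)"
      using b[OF kn] m_pos by (intro mult_right_mono) auto
    ultimately have "A $$ (k, k) * (m * b k) \<le> (\<Sum>j\<in>?J. - A $$ (k, j) * \<bar>v $ j\<bar>)"
      by linarith
    \<comment> \<open>Both summands are nonnegative, so both vanish; the second then puts every
      successor \<open>j\<close> of \<open>k\<close> into \<open>T\<close>.\<close>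
    then have le: "m * (\<Sum>j<n. A $$ (k, j) * b j) + (\<Sum>j\<in>?J. - A $$ (k, j) * (m * b j - \<bar>v $ j\<bar>)) \<le> 0"
      by (simp add: split algebra_simps sum_distrib_left sum_subtractf sum_negf)
    have nn: "- A $$ (k, j) * (m * b j - \<bar>v $ j\<bar>) \<ge> 0" if "j \<in> ?J" for j
      using off[OF kn, of j] bound[of j] that by (intro mult_nonneg_nonneg) auto
    have "(\<Sum>j\<in>?J. - A $$ (k, j) * (m * b j - \<bar>v $ j\<bar>)) \<ge> 0"
      using nn by (rule sum_nonneg)
    moreover have "m * (\<Sum>j<n. A $$ (k, j) * b j) \<ge> 0" using m_pos Ab[OF kn] by simp
    ultimately have z: "m * (\<Sum>j<n. A $$ (k, j) * b j) = 0"
      "(\<Sum>j\<in>?J. - A $$ (k, j) * (m * b j - \<bar>v $ j\<bar>)) = 0" using le by linarith+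
    have "\<forall>j\<in>?J. - A $$ (k, j) * (m * b j - \<bar>v $ j\<bar>) = 0"
      using z(2) nn by (subst (asm) sum_nonneg_eq_0_iff) auto
    with z(1) m_pos k show ?thesis by (auto simp: T_def)
  qed
  \<comment> \<open>\<open>key\<close> closes \<open>T\<close> under successors, so its complement
    is predecessor-closed; it is proper because \<open>k0\<close> lies in \<open>T\<close>.\<close>
  have "{..<n} - T = {}"
  proof (rule ccontr)
    assume "{..<n} - T \<noteq> {}"
    then have "{..<n} - T = {..<n}"
      by (intro irreducible_matD[OF irr]) (use key in auto)
    then show False using k0 by (auto simp: T_def)
  qed
  with r(1) have "r \<in> T" by auto
  from key[OF this] r(2) show False by simp
qed

text \<open>The polynomial \<open>p\<close> takes the value det (A + t I) at \<open>t\<close> and is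
  eventually positive. With \<open>poly p 0 \<le> 0\<close> it would have a root
  \<open>t \<ge> 0\<close>, but A + t I satisfies the hypotheses of the kernel lemma.\<close>

lemma Z_matrix_det_pos:
  fixes A :: "real mat" and b :: "nat \<Rightarrow> real"
  assumes A: "A \<in> carrier_mat n n"
    and off: "\<And>i j. i < n \<Longrightarrow> j < n \<Longrightarrow> i \<noteq> j \<Longrightarrow> A $$ (i, j) \<le> 0"
    and b: "\<And>i. i < n \<Longrightarrow> b i > 0"
    and Ab: "\<And>i. i < n \<Longrightarrow> (\<Sum>j<n. A $$ (i, j) * b j) \<ge> 0"
    and r: "r < n" "(\<Sum>j<n. A $$ (r, j) * b j) > 0"
    and irr: "irreducible_mat n A"
  shows "det A > 0"
proof (rule ccontr)
  assume "\<not> det A > 0"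
  define p where "p = char_poly (- A)"
  have mA: "- A \<in> carrier_mat n n" using A by simp
  have "poly p 0 = det A"
    unfolding p_def char_poly_matrix[OF mA]
    by (rule arg_cong[of _ _ det]) (use A in \<open>auto simp: char_matrix_def\<close>)
  with \<open>\<not> det A > 0\<close> have p0: "poly p 0 \<le> 0" by simp
  have "lead_coeff p = 1" using degree_monic_char_poly[OF mA] by (simp add: p_def)
  then obtain N where N: "\<And>x. x \<ge> N \<Longrightarrow> poly p x \<ge> 1"
    using poly_pinfty_gt_lc[of p] by auto
  \<comment> \<open>\<open>N\<close> may be negative, while the intermediate value theorem needs a
    point to the right of \<open>0\<close>.\<close>
  have "\<exists>c>0. poly p c > 0" using N[of "max N 1"] by (intro exI[of _ "max N 1"]) auto
  then obtain c where c: "c > 0" "poly p c > 0" by blast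
  have "\<exists>t\<ge>0. poly p t = 0"
  proof (cases "poly p 0 = 0")
    case False
    with p0 have "poly p 0 < 0" by simp
    then obtain t where "0 < t" "poly p t = 0"
      using poly_IVT_pos[of 0 c p] c by blast
    then show ?thesis by (intro exI[of _ t]) auto
  qed auto
  then obtain t where t: "t \<ge> 0" "poly p t = 0" by blast
  then have "eigenvalue (- A) t" unfolding p_def using eigenvalue_root_char_poly[OF mA] by simp
  then obtain v where v: "v \<in> carrier_vec n" "v \<noteq> 0\<^sub>v n" "- A *\<^sub>v v = t \<cdot>\<^sub>v v"
    using mA by (auto simp: eigenvalue_def eigenvector_def)
  define B where "B = A + t \<cdot>\<^sub>m 1\<^sub>m n"
  have B: "B \<in> carrier_mat n n" using A by (simp add: B_def)
  have B_ix: "B $$ (i, j) = A $$ (i, j) + (if i = j then t else 0)" if "i < n" "j < n" for i j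
    using A that by (simp add: B_def)
  have B_sum: "(\<Sum>j<n. B $$ (i, j) * f j) = (\<Sum>j<n. A $$ (i, j) * f j) + t * f i" if "i < n" for i f
    using that by (simp add: B_ix distrib_right sum.distrib if_distrib[of "\<lambda>x. x * _"] cong: if_cong)
  have "v = 0\<^sub>v n"
  proof (rule Z_matrix_kernel_trivial[where A = B and b = b and r = r])
    show "B $$ (i, j) \<le> 0" if "i < n" "j < n" "i \<noteq> j" for i j
      using off that by (simp add: B_ix)
    show "(\<Sum>j<n. B $$ (i, j) * b j) \<ge> 0" if "i < n" for i
      using Ab[OF that] b[OF that] t(1) by (simp add: B_sum that)
    show "(\<Sum>j<n. B $$ (r, j) * b j) > 0"
      using r b[OF r(1)] t(1) by (simp add: B_sum add_pos_nonneg)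
    show "irreducible_mat n B"
      unfolding irreducible_mat_def
    proof (intro allI impI)
      fix Z assume Z: "Z \<subseteq> {..<n}" "Z \<noteq> {}" "\<forall>k<n. \<forall>j\<in>Z. B $$ (k, j) \<noteq> 0 \<longrightarrow> k \<in> Z"
      show "Z = {..<n}"
      proof (rule irreducible_matD[OF irr Z(1,2)])
        fix k j assume kj: "k < n" "j \<in> Z" "A $$ (k, j) \<noteq> 0"
        then have "j < n" using Z(1) by auto
        show "k \<in> Z"
        \<comment> \<open>\<open>A\<close> and \<open>B\<close> may differ on the diagonal, where
          the closure condition is trivial.\<close>
        proof (cases "k = j")
          case False
          then have "B $$ (k, j) \<noteq> 0" using kj \<open>j < n\<close> by (simp add: B_ix)
          with Z(3) kj show ?thesis by blast
        qed (use kj in simp)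
      qed
    qed
    show "B *\<^sub>v v = 0\<^sub>v n"
      unfolding mult_mat_vec_eq_0_iff[OF B v(1)]
    proof (intro allI impI)
      fix i assume i: "i < n"
      have "(\<Sum>j<n. (- A) $$ (i, j) * v $ j) = t * v $ i"
        using arg_cong[OF v(3), of "\<lambda>w. w $ i"] i v(1)
        unfolding mult_mat_vec_index[OF mA v(1) i] by simp
      then have "(\<Sum>j<n. A $$ (i, j) * v $ j) = - (t * v $ i)"
        using A i by (simp add: sum_negf)
      then show "(\<Sum>j<n. B $$ (i, j) * v $ j) = 0" by (simp add: B_sum i)
    qed
  qed (use B b r v in auto)
  with v(2) show False by simp
qed

section \<open>The adjugate of a GCB matrix\<close>

text \<open>A rank-one perturbation whose determinant reads off a diagonal entry of the adjugate
  when \<open>det A = 0\<close>.\<close>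

definition bump_diag :: "nat \<Rightarrow> nat \<Rightarrow> 'a::comm_ring_1 mat \<Rightarrow> 'a mat" where
  "bump_diag n r A = mat n n (\<lambda>(i, j). A $$ (i, j) + (if i = r \<and> j = r then 1 else 0))"

lemma bump_diag_carrier [simp]: "bump_diag n r A \<in> carrier_mat n n"
  by (simp add: bump_diag_def)

lemma bump_diag_index:
  "i < n \<Longrightarrow> j < n \<Longrightarrow> bump_diag n r A $$ (i, j) = A $$ (i, j) + (if i = r \<and> j = r then 1 else 0)"
  by (simp add: bump_diag_def)

lemma bump_diag_sum:
  assumes "i < n" "r < n"
  shows "(\<Sum>j<n. bump_diag n r A $$ (i, j) * f j) =
    (\<Sum>j<n. A $$ (i, j) * f j) + (if i = r then f r else 0)"
proof -
  have "(\<Sum>j<n. bump_diag n r A $$ (i, j) * f j) =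
    (\<Sum>j<n. A $$ (i, j) * f j + (if j = r then if i = r then f r else 0 else 0))"
    using assms by (intro sum.cong) (auto simp: bump_diag_index distrib_right)
  with assms show ?thesis by (simp add: sum.distrib)
qed

text \<open>Expand along row \<open>r\<close>: the cofactors of that row do not involve its entries,
  so only one summand changes.\<close>

lemma det_bump_diag:
  assumes A: "A \<in> carrier_mat n n" and r: "r < n"
  shows "det (bump_diag n r A) = det A + adj_mat A $$ (r, r)"
proof -
  have cof: "cofactor (bump_diag n r A) r j = cofactor A r j" if "j < n" for j
  proof -
    have "mat_delete (bump_diag n r A) r j = mat_delete A r j"
      using A that r by (intro eq_matI) (auto simp: mat_delete_def bump_diag_def)
    then show ?thesis by (simp add: cofactor_def)
  qed
  have "det (bump_diag n r A) = (\<Sum>j<n. bump_diag n r A $$ (r, j) * cofactor A r j)"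
    unfolding laplace_expansion_row[OF bump_diag_carrier r] using cof by simp
  also have "\<dots> = det A + cofactor A r r"
    by (simp add: bump_diag_sum r laplace_expansion_row[OF A r])
  finally show ?thesis using A r by (simp add: adj_mat_def)
qed

lemma gcb_matrix_det_eq_0:
  assumes "gcb_matrix s L" "s > 0"
  shows "det L = 0"
proof -
  obtain b where "b \<in> carrier_vec s" "\<forall>i<s. b $ i > 0" "L *\<^sub>v b = 0\<^sub>v s"
    using assms(1) by (auto simp: gcb_matrix_def)
  moreover from this assms(2) have "b \<noteq> 0\<^sub>v s" by auto
  ultimately show ?thesis
    using assms(1) by (subst det_0_iff_vec_prod_zero[of _ s]) (auto simp: gcb_matrix_def)
qed

text \<open>Positivity at \<open>(j, j)\<close> comes from the determinant of \<open>D\<close>; the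
  rest of column \<open>j\<close> follows because the column is shown to be proportional to
  \<open>b\<close>, both lying in the kernel of \<open>L\<close>.\<close>

lemma gcb_matrix_adj_pos:
  assumes gcb: "gcb_matrix s L" and irr: "irreducible_mat s L" and ij: "i < s" "j < s"
  shows "adj_mat L $$ (i, j) > 0"
proof -
  have L: "L \<in> carrier_mat s s" using gcb by (simp add: gcb_matrix_def)
  have off: "L $$ (k, l) \<le> 0" if "k < s" "l < s" "k \<noteq> l" for k l
    using gcb that by (auto simp: gcb_matrix_def)
  obtain b where b: "b \<in> carrier_vec s" "\<And>i. i < s \<Longrightarrow> b $ i > 0" "L *\<^sub>v b = 0\<^sub>v s"
    using gcb by (auto simp: gcb_matrix_def)
  have Lb: "(\<Sum>l<s. L $$ (k, l) * b $ l) = 0" if "k < s" for k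
    using b(3) that unfolding mult_mat_vec_eq_0_iff[OF L b(1)] by blast
  have diag: "L $$ (k, k) > 0" if "k < s" for k using gcb that by (auto simp: gcb_matrix_def)
  have det0: "det L = 0" using gcb_matrix_det_eq_0 gcb ij by auto
  define D where "D = bump_diag s j L"
  \<comment> \<open>The determinant criterion rests on the intermediate value theorem, hence the
    passage to the reals.\<close>
  define R where "R = map_mat real_of_int D"
  have D: "D \<in> carrier_mat s s" by (simp add: D_def)
  have R_ix: "R $$ (k, l) = of_int (D $$ (k, l))" if "k < s" "l < s" for k l
    using D that by (simp add: R_def)
  have Db: "(\<Sum>l<s. D $$ (k, l) * b $ l) = (if k = j then b $ j else 0)" if "k < s" for k
    unfolding D_def bump_diag_sum[OF that ij(2)] by (simp add: Lb that)
  have Rb: "(\<Sum>l<s. R $$ (k, l) * of_int (b $ l)) = of_int (if k = j then b $ j else 0)" if "k < s" for k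
  proof -
    have "(\<Sum>l<s. R $$ (k, l) * of_int (b $ l)) = of_int (\<Sum>l<s. D $$ (k, l) * b $ l)"
      unfolding of_int_sum of_int_mult using that by (intro sum.cong) (auto simp: R_ix)
    then show ?thesis by (simp only: Db[OF that])
  qed
  have "det R > 0"
  proof (rule Z_matrix_det_pos[where b = "\<lambda>i. of_int (b $ i)" and r = j])
    show "R $$ (k, l) \<le> 0" if "k < s" "l < s" "k \<noteq> l" for k l
      using off that by (auto simp: R_ix D_def bump_diag_index)
    show "irreducible_mat s R"
      unfolding irreducible_mat_def
    proof (intro allI impI)
      fix Z assume Z: "Z \<subseteq> {..<s}" "Z \<noteq> {}" "\<forall>k<s. \<forall>l\<in>Z. R $$ (k, l) \<noteq> 0 \<longrightarrow> k \<in> Z"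
      show "Z = {..<s}"
      proof (rule irreducible_matD[OF irr Z(1,2)])
        fix k l assume kl: "k < s" "l \<in> Z" "L $$ (k, l) \<noteq> 0"
        then have "l < s" using Z(1) by auto
        \<comment> \<open>Adding \<open>1\<close> at \<open>(j, j)\<close> cancels no entry, since
          the diagonal of \<open>L\<close> is positive.\<close>
        with kl have "R $$ (k, l) \<noteq> 0"
          using diag[of k] by (auto simp: R_ix D_def bump_diag_index)
        with kl Z(3) show "k \<in> Z" by auto
      qed
    qed
    show "(\<Sum>l<s. R $$ (k, l) * of_int (b $ l)) \<ge> 0" if "k < s" for k
      using b(2)[OF ij(2)] unfolding Rb[OF that] by simp
    show "(\<Sum>l<s. R $$ (j, l) * of_int (b $ l)) > 0"
      using b(2)[OF ij(2)] unfolding Rb[OF ij(2)] by simp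
  qed (use D b ij in \<open>auto simp: R_def\<close>)
  then have detD: "det D > 0" by (simp add: R_def of_int_hom.hom_det)
  then have adj_jj: "adj_mat L $$ (j, j) > 0"
    using det_bump_diag[OF L ij(2)] det0 by (simp add: D_def)
  define v where "v = (\<lambda>i. adj_mat L $$ (i, j))"
  have Lv: "(\<Sum>l<s. L $$ (k, l) * v l) = 0" if "k < s" for k
  proof -
    have "(L * adj_mat L) $$ (k, j) = 0"
      using adj_mat(2)[OF L] det0 that ij by simp
    then show ?thesis
      using L adj_mat(1)[OF L] that ij
      by (simp add: v_def scalar_prod_def atLeast0LessThan)
  qed
  \<comment> \<open>The combination of the kernel vectors \<open>v\<close> and \<open>b\<close> that
    vanishes at \<open>j\<close>: the perturbation does not see it, so the nonsingular
    \<open>D\<close> annihilates it too and it is zero.\<close>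
  define w where "w = vec s (\<lambda>k. b $ j * v k - v j * b $ k)"
  have w: "w \<in> carrier_vec s" by (simp add: w_def)
  have "D *\<^sub>v w = 0\<^sub>v s"
    unfolding mult_mat_vec_eq_0_iff[OF D w]
  proof (intro allI impI)
    fix k assume k: "k < s"
    have "(\<Sum>l<s. L $$ (k, l) * w $ l) =
        b $ j * (\<Sum>l<s. L $$ (k, l) * v l) - v j * (\<Sum>l<s. L $$ (k, l) * b $ l)"
      by (simp add: w_def sum_distrib_left sum_subtractf[symmetric] algebra_simps)
    also have "\<dots> = 0" by (simp add: Lv Lb k)
    finally show "(\<Sum>l<s. D $$ (k, l) * w $ l) = 0"
      unfolding D_def bump_diag_sum[OF k ij(2)] using ij by (simp add: w_def)
  qed
  with detD det_0_iff_vec_prod_zero[OF D] w have "w = 0\<^sub>v s" by fastforce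
  then have "w $ i = 0" using ij by simp
  then have "b $ j * v i = v j * b $ i" using ij by (simp add: w_def)
  moreover have "v j * b $ i > 0" using adj_jj b ij by (simp add: v_def)
  ultimately have "b $ j * v i > 0" by simp
  from zero_less_mult_pos[OF this b(2)[OF ij(2)]] show ?thesis by (simp add: v_def)
qed

lemma gcb_matrix_irreducible_if_adj_pos:
  assumes gcb: "gcb_matrix s L" and pos: "\<And>i j. i < s \<Longrightarrow> j < s \<Longrightarrow> adj_mat L $$ (i, j) > 0"
  shows "irreducible_mat s L"
proof (rule ccontr)
  have L: "L \<in> carrier_mat s s" using gcb by (simp add: gcb_matrix_def)
  have off: "L $$ (k, l) \<le> 0" if "k < s" "l < s" "k \<noteq> l" for k l
    using gcb that by (auto simp: gcb_matrix_def)
  obtain b where b: "b \<in> carrier_vec s" "\<And>i. i < s \<Longrightarrow> b $ i > 0" "L *\<^sub>v b = 0\<^sub>v s"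
    using gcb by (auto simp: gcb_matrix_def)
  assume "\<not> irreducible_mat s L"
  then obtain Z where Z: "Z \<subset> {..<s}" "Z \<noteq> {}"
    and closed: "\<And>k j. k < s \<Longrightarrow> j \<in> Z \<Longrightarrow> L $$ (k, j) \<noteq> 0 \<Longrightarrow> k \<in> Z"
    by (rule not_irreducible_matE) blast
  obtain z where z: "z \<in> Z" "z < s" using Z by auto
  obtain r where r: "r \<notin> Z" "r < s" using Z by auto
  have det0: "det L = 0" using gcb_matrix_det_eq_0 gcb z by auto
  define u where "u = vec s (\<lambda>i. if i \<in> Z then b $ i else 0)"
  have u: "u \<in> carrier_vec s" by (simp add: u_def)
  define y where "y = (\<lambda>k. \<Sum>l<s. L $$ (k, l) * u $ l)"
  \<comment> \<open>A row in \<open>Z\<close> loses only nonpositive terms in passing from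
    \<open>b\<close> to \<open>u\<close>; a row outside \<open>Z\<close> has no nonzero entry in the
    columns of \<open>Z\<close>.\<close>
  have y_nonneg: "y k \<ge> 0" if k: "k < s" for k
  proof (cases "k \<in> Z")
    case True
    have "0 = (\<Sum>l<s. L $$ (k, l) * b $ l)"
      using b(3) k unfolding mult_mat_vec_eq_0_iff[OF L b(1)] by simp
    also have "\<dots> \<le> y k"
      unfolding y_def
    proof (rule sum_mono)
      fix l assume "l \<in> {..<s}"
      then have l: "l < s" by simp
      show "L $$ (k, l) * b $ l \<le> L $$ (k, l) * u $ l"
      proof (cases "l \<in> Z")
        case False
        with True have "k \<noteq> l" by auto
        then show ?thesis
          using False l off[OF k l] b(2)[OF l] by (simp add: u_def mult_nonpos_nonneg)
      qed (simp add: u_def l)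
    qed
    finally show ?thesis .
  next
    case False
    then have "L $$ (k, l) * u $ l = 0" if "l < s" for l
      using closed[OF k, of l] that by (cases "l \<in> Z") (auto simp: u_def)
    then have "y k = 0" unfolding y_def by (intro sum.neutral) simp
    then show ?thesis by simp
  qed
  \<comment> \<open>\<open>adj_mat L * L\<close> is \<open>det L\<close> times the identity, hence
    zero; the positive weights in row \<open>z\<close> then force each \<open>y k\<close> to
    vanish.\<close>
  have "(\<Sum>k<s. adj_mat L $$ (z, k) * y k) =
      (\<Sum>k<s. \<Sum>l<s. adj_mat L $$ (z, k) * L $$ (k, l) * u $ l)"
    by (simp add: y_def sum_distrib_left mult.assoc)
  also have "\<dots> = (\<Sum>l<s. \<Sum>k<s. adj_mat L $$ (z, k) * L $$ (k, l) * u $ l)"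
    by (rule sum.swap)
  also have "\<dots> = (\<Sum>l<s. (adj_mat L * L) $$ (z, l) * u $ l)"
    using L adj_mat(1)[OF L] z
    by (simp add: scalar_prod_def atLeast0LessThan sum_distrib_right)
  also have "\<dots> = 0" using adj_mat(3)[OF L] det0 z by simp
  finally have sum0: "(\<Sum>k<s. adj_mat L $$ (z, k) * y k) = 0" .
  have "adj_mat L $$ (z, k) * y k \<ge> 0" if "k \<in> {..<s}" for k
    using pos[OF z(2), of k] y_nonneg[of k] that by (intro mult_nonneg_nonneg) auto
  then have "\<forall>k\<in>{..<s}. adj_mat L $$ (z, k) * y k = 0"
    using sum0 sum_nonneg_eq_0_iff[of "{..<s}" "\<lambda>k. adj_mat L $$ (z, k) * y k"] by blast
  then have y0: "y k = 0" if "k < s" for k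
    using pos[OF z(2) that] that by (metis lessThan_iff less_irrefl mult_eq_0_iff)
  \<comment> \<open>\<open>u\<close> vanishes at \<open>r\<close>, so the perturbation at
    \<open>r\<close> leaves it in the kernel.\<close>
  have "bump_diag s r L *\<^sub>v u = 0\<^sub>v s"
    unfolding mult_mat_vec_eq_0_iff[OF bump_diag_carrier u]
    using y0 r by (auto simp: bump_diag_sum y_def u_def)
  moreover have "u \<noteq> 0\<^sub>v s" using z b(2)[of z] by (auto simp: u_def vec_eq_iff)
  ultimately have "det (bump_diag s r L) = 0"
    using u det_0_iff_vec_prod_zero[OF bump_diag_carrier] by blast
  then have "adj_mat L $$ (r, r) = 0" using det_bump_diag[OF L r(2)] det0 by simp
  with pos[OF r(2) r(2)] show False by simp
qed

section \<open>Evaluation as a ring homomorphism\<close>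

definition monomial_eval :: "'k::field vec \<Rightarrow> (nat \<Rightarrow>\<^sub>0 nat) \<Rightarrow> 'k" where
  "monomial_eval x m = (\<Prod>i \<in> Poly_Mapping.keys m. (x $ i) ^ Poly_Mapping.lookup m i)"

text \<open>A common finite index set makes evaluations of different monomials comparable; the extra
  factors have exponent \<open>0\<close>.\<close>

lemma monomial_eval_superset:
  assumes "finite S" "Poly_Mapping.keys m \<subseteq> S"
  shows "monomial_eval x m = (\<Prod>i\<in>S. (x $ i) ^ Poly_Mapping.lookup m i)"
  unfolding monomial_eval_def using assms
  by (intro prod.mono_neutral_left) (auto simp: in_keys_iff)

lemma monomial_eval_add: "monomial_eval x (a + b) = monomial_eval x a * monomial_eval x b"
proof -
  let ?S = "Poly_Mapping.keys a \<union> Poly_Mapping.keys b"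
  have "Poly_Mapping.keys (a + b) \<subseteq> ?S" by (rule Poly_Mapping.keys_add)
  then show ?thesis
    by (simp add: monomial_eval_superset[of ?S] lookup_add power_add prod.distrib)
qed

lemma poly_eval_superset:
  assumes "finite S" "Poly_Mapping.keys f \<subseteq> S"
  shows "poly_eval x f = (\<Sum>m\<in>S. Poly_Mapping.lookup f m * monomial_eval x m)"
  unfolding poly_eval_def monomial_eval_def using assms
  by (intro sum.mono_neutral_left) (auto simp: in_keys_iff)

lemma poly_eval_0 [simp]: "poly_eval x 0 = 0"
  by (simp add: poly_eval_def)

lemma poly_eval_add: "poly_eval x (f + g) = poly_eval x f + poly_eval x g"
proof -
  let ?S = "Poly_Mapping.keys f \<union> Poly_Mapping.keys g"
  have "Poly_Mapping.keys (f + g) \<subseteq> ?S" by (rule Poly_Mapping.keys_add)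
  then show ?thesis
    by (simp add: poly_eval_superset[of ?S] lookup_add distrib_right sum.distrib)
qed

lemma poly_eval_uminus: "poly_eval x (- f) = - poly_eval x f"
  using poly_eval_add[of x f "- f"] by (simp add: eq_neg_iff_add_eq_0 add.commute)

lemma poly_eval_diff: "poly_eval x (f - g) = poly_eval x f - poly_eval x g"
  using poly_eval_add[of x f "- g"] by (simp add: poly_eval_uminus)

lemma poly_eval_sum: "poly_eval x (\<Sum>i\<in>S. f i) = (\<Sum>i\<in>S. poly_eval x (f i))"
  by (induction S rule: infinite_finite_induct) (simp_all add: poly_eval_add)

lemma poly_eval_single: "poly_eval x (Poly_Mapping.single m c) = c * monomial_eval x m"
  by (simp add: poly_eval_def monomial_eval_def)

lemma sum_single_keys:
  "(\<Sum>m\<in>Poly_Mapping.keys f. Poly_Mapping.single m (Poly_Mapping.lookup f m)) = f"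
  by (rule poly_mapping_eqI)
    (auto simp: lookup_sum lookup_single when_def in_keys_iff)

text \<open>Splitting both factors into single terms reduces this to \<open>mult_single\<close> and
  multiplicativity on monomials.\<close>

lemma poly_eval_mult: "poly_eval x (f * g) = poly_eval x f * poly_eval x g"
proof -
  let ?s = "\<lambda>f m. Poly_Mapping.single m (Poly_Mapping.lookup f m)"
  have "f * g = (\<Sum>a\<in>Poly_Mapping.keys f. ?s f a) * (\<Sum>b\<in>Poly_Mapping.keys g. ?s g b)"
    by (simp only: sum_single_keys)
  also have "\<dots> = (\<Sum>a\<in>Poly_Mapping.keys f. \<Sum>b\<in>Poly_Mapping.keys g.
      Poly_Mapping.single (a + b) (Poly_Mapping.lookup f a * Poly_Mapping.lookup g b))"
    by (simp add: sum_product mult_single)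
  finally show ?thesis
    by (simp add: poly_eval_sum poly_eval_single monomial_eval_add sum_product mult_ac
        poly_eval_superset[OF finite_keys subset_refl, of _ f]
        poly_eval_superset[OF finite_keys subset_refl, of _ g])
qed

lemma poly_eval_1 [simp]: "poly_eval x 1 = 1"
  by (simp add: monomial_eval_def poly_eval_single flip: single_one)

lemma poly_eval_var [simp]: "poly_eval x (poly_var i) = x $ i"
  by (simp add: poly_var_def poly_eval_single monomial_eval_def)

lemma poly_eval_power: "poly_eval x (f ^ n) = poly_eval x f ^ n"
  by (induction n) (simp_all add: poly_eval_mult)

lemma poly_eval_prod: "poly_eval x (\<Prod>i\<in>S. f i) = (\<Prod>i\<in>S. poly_eval x (f i))"
  by (induction S rule: infinite_finite_induct) (simp_all add: poly_eval_mult)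

lemma poly_eval_vec_binomial:
  "poly_eval x (vec_binomial a) =
     (\<Prod>i<dim_vec a. x $ i ^ nat (a $ i)) - (\<Prod>i<dim_vec a. x $ i ^ nat (- (a $ i)))"
  by (simp add: vec_binomial_def poly_eval_diff poly_eval_prod poly_eval_power)

section \<open>Zero loci of generated ideals\<close>

lemma poly_ring_simps:
  "a \<otimes>\<^bsub>poly_ring s\<^esub> b = a * b" "a \<oplus>\<^bsub>poly_ring s\<^esub> b = a + b"
  "\<one>\<^bsub>poly_ring s\<^esub> = 1" "\<zero>\<^bsub>poly_ring s\<^esub> = 0"
  by (simp_all add: poly_ring_def)

lemma uminus_in_poly_ring: "f \<in> carrier (poly_ring s) \<Longrightarrow> - f \<in> carrier (poly_ring s)"
  by (simp add: poly_ring_def)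

lemma prod_var_in_poly_ring:
  assumes "S \<subseteq> {..<s}"
  shows "(\<Prod>i\<in>S. poly_var i ^ e i) \<in> carrier (poly_ring s :: 'k::field mvpoly ring)"
proof -
  interpret cring "poly_ring s :: 'k mvpoly ring" by (rule poly_ring_is_cring)
  have "poly_var i ^ n \<in> carrier (poly_ring s :: 'k mvpoly ring)" if "i < s" for i n
    by (induction n)
      (use one_closed m_closed poly_var_in_poly_ring[OF that] in \<open>auto simp: poly_ring_simps\<close>)
  then show ?thesis using assms
    by (induction S rule: infinite_finite_induct)
      (use one_closed m_closed in \<open>auto simp: poly_ring_simps\<close>)
qed

lemma vec_binomial_in_poly_ring:
  assumes "dim_vec a = s"
  shows "vec_binomial a \<in> carrier (poly_ring s :: 'k::field mvpoly ring)"
proof -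
  interpret cring "poly_ring s :: 'k mvpoly ring" by (rule poly_ring_is_cring)
  have var: "(\<Prod>i<s. poly_var i ^ e i) \<in> carrier (poly_ring s :: 'k mvpoly ring)" for e
    by (rule prod_var_in_poly_ring) simp
  have "(\<Prod>i<s. poly_var i ^ nat (a $ i)) + - (\<Prod>i<s. poly_var i ^ nat (- (a $ i)))
      \<in> carrier (poly_ring s :: 'k mvpoly ring)"
    by (rule a_closed[OF var uminus_in_poly_ring[OF var], unfolded poly_ring_simps])
  then show ?thesis by (simp add: vec_binomial_def assms)
qed

text \<open>A generated ideal is an intersection of ideals; this member of it shows that a common
  zero of the generators is a zero of the whole ideal.\<close>

lemma ideal_vanishing_at:
  "ideal {f \<in> carrier (poly_ring s). poly_eval x f = 0} (poly_ring s :: 'k::field mvpoly ring)"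
proof -
  interpret cring "poly_ring s :: 'k mvpoly ring" by (rule poly_ring_is_cring)
  have inv: "\<ominus>\<^bsub>poly_ring s\<^esub> f = - f" if "f \<in> carrier (poly_ring s)" for f :: "'k mvpoly"
    using that uminus_in_poly_ring[OF that] by (intro minus_equality) (auto simp: poly_ring_simps)
  show ?thesis
  proof (rule idealI)
    show "subgroup {f \<in> carrier (poly_ring s). poly_eval x f = 0}
        (add_monoid (poly_ring s :: 'k mvpoly ring))"
      by (rule add.subgroupI)
        (use a_closed zero_closed uminus_in_poly_ring in
          \<open>auto simp: poly_ring_simps poly_eval_add poly_eval_uminus inv a_inv_def[symmetric]\<close>)
  qed (use m_closed in \<open>auto simp: poly_ring_simps poly_eval_mult ring_axioms\<close>)
qed

lemma zero_locus_genideal: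
  fixes F :: "'k::field mvpoly set"
  assumes "F \<subseteq> carrier (poly_ring s)"
  shows "zero_locus s (Idl\<^bsub>poly_ring s\<^esub> F) = zero_locus s F"
proof -
  have "poly_eval x f = 0" if "f \<in> Idl\<^bsub>poly_ring s\<^esub> F" "\<forall>g\<in>F. poly_eval x g = 0" for x f
    using that assms ideal_vanishing_at[of s x] unfolding genideal_def by blast
  moreover have "F \<subseteq> Idl\<^bsub>poly_ring s\<^esub> F" by (auto simp: genideal_def)
  ultimately show ?thesis unfolding zero_locus_def by blast
qed

text \<open>Needed because the ideal \<open>I\<close> itself serves among the generators of the
  ideal (I, t_i).\<close>

lemma genideal_in_poly_ring:
  assumes "F \<subseteq> carrier (poly_ring s :: 'k::field mvpoly ring)"
  shows "Idl\<^bsub>poly_ring s\<^esub> F \<subseteq> carrier (poly_ring s)"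
proof -
  interpret cring "poly_ring s :: 'k mvpoly ring" by (rule poly_ring_is_cring)
  from genideal_ideal[OF assms] show ?thesis by (auto dest: ideal.Icarr)
qed

text \<open>Since the diagonal of \<open>L\<close> is its only positive part, the binomial of row \<open>k\<close> is
  \<open>t\<^sub>k\<close> to the power \<open>L $$ (k, k)\<close> minus a monomial in the out-neighbours of \<open>k\<close>.\<close>

lemma in_zero_locus_iff:
  fixes x :: "'k::field vec"
  assumes gcb: "gcb_matrix s L" and i: "i < s"
  shows "x \<in> zero_locus s (Idl\<^bsub>poly_ring s\<^esub> (insert (poly_var i) (matrix_ideal (transpose_mat L))))
    \<longleftrightarrow> x \<in> carrier_vec s \<and> x $ i = 0 \<and>
      (\<forall>k<s. x $ k ^ nat (L $$ (k, k)) = (\<Prod>j\<in>{..<s} - {k}. x $ j ^ nat (- L $$ (k, j))))"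
proof -
  have L: "L \<in> carrier_mat s s" using gcb by (simp add: gcb_matrix_def)
  let ?P = "poly_ring s :: 'k mvpoly ring"
  let ?G = "vec_binomial ` set (rows L) :: 'k mvpoly set"
  have I: "matrix_ideal (transpose_mat L) = Idl\<^bsub>?P\<^esub> ?G"
    using L by (simp add: matrix_ideal_def)
  have G: "?G \<subseteq> carrier ?P"
    using L by (auto simp: rows_def intro!: vec_binomial_in_poly_ring)
  \<comment> \<open>Only generators matter at both levels: first those of (I, t_i), then those of
    \<open>I\<close>.\<close>
  have "zero_locus s (Idl\<^bsub>?P\<^esub> (insert (poly_var i) (Idl\<^bsub>?P\<^esub> ?G)))
      = zero_locus s (insert (poly_var i) (Idl\<^bsub>?P\<^esub> ?G))"
    using G i by (intro zero_locus_genideal) (simp add: genideal_in_poly_ring poly_var_in_poly_ring)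
  also have "\<dots> = zero_locus s (Idl\<^bsub>?P\<^esub> ?G) \<inter> {x. x $ i = 0}"
    by (auto simp: zero_locus_def)
  also have "\<dots> = zero_locus s ?G \<inter> {x. x $ i = 0}" by (simp only: zero_locus_genideal[OF G])
  finally have locus: "zero_locus s (Idl\<^bsub>?P\<^esub> (insert (poly_var i) (matrix_ideal (transpose_mat L))))
      = zero_locus s ?G \<inter> {x. x $ i = 0}" by (simp only: I)
  have "poly_eval x (vec_binomial (row L k)) =
      x $ k ^ nat (L $$ (k, k)) - (\<Prod>j\<in>{..<s} - {k}. x $ j ^ nat (- L $$ (k, j)))" if k: "k < s" for k
  proof -
    have diag: "L $$ (k, k) > 0" and off: "\<And>j. j < s \<Longrightarrow> j \<noteq> k \<Longrightarrow> L $$ (k, j) \<le> 0"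
      using gcb k by (auto simp: gcb_matrix_def)
    have "(\<Prod>j<s. x $ j ^ nat (row L k $ j)) =
        x $ k ^ nat (L $$ (k, k)) * (\<Prod>j\<in>{..<s} - {k}. x $ j ^ nat (row L k $ j))"
      using L k by (simp add: prod.remove[of "{..<s}" k])
    also have "(\<Prod>j\<in>{..<s} - {k}. x $ j ^ nat (row L k $ j)) = 1"
      using L k off by (intro prod.neutral) auto
    finally have plus: "(\<Prod>j<s. x $ j ^ nat (row L k $ j)) = x $ k ^ nat (L $$ (k, k))" by simp
    have "(\<Prod>j<s. x $ j ^ nat (- (row L k $ j))) =
        (\<Prod>j\<in>{..<s} - {k}. x $ j ^ nat (- (row L k $ j)))"
      using L k diag by (simp add: prod.remove[of "{..<s}" k])
    also have "\<dots> = (\<Prod>j\<in>{..<s} - {k}. x $ j ^ nat (- L $$ (k, j)))"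
      using L k by (intro prod.cong) auto
    finally show ?thesis using plus L by (simp add: poly_eval_vec_binomial)
  qed
  moreover have "set (rows L) = row L ` {..<s}" using L by (auto simp: rows_def)
  ultimately show ?thesis unfolding locus by (auto simp: zero_locus_def)
qed

section \<open>Zero patterns of points\<close>

text \<open>The definition asks for this in columns only; for rows it follows from L b = 0, as a
  lone positive diagonal entry cannot be balanced. It makes the origin satisfy the binomial
  equations.\<close>

lemma gcb_matrix_row_nonzero:
  assumes gcb: "gcb_matrix s L" and k: "k < s"
  obtains j where "j < s" "j \<noteq> k" "L $$ (k, j) \<noteq> 0"
proof (rule ccontr)
  assume contr: "\<not> thesis"
  have L: "L \<in> carrier_mat s s" and diag: "L $$ (k, k) > 0"
    using gcb k by (auto simp: gcb_matrix_def)
  obtain b where b: "b \<in> carrier_vec s" "b $ k > 0" "L *\<^sub>v b = 0\<^sub>v s"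
    using gcb k by (auto simp: gcb_matrix_def)
  have "0 = (\<Sum>j<s. L $$ (k, j) * b $ j)"
    using b(3) k unfolding mult_mat_vec_eq_0_iff[OF L b(1)] by simp
  also have "\<dots> = L $$ (k, k) * b $ k + (\<Sum>j\<in>{..<s} - {k}. L $$ (k, j) * b $ j)"
    using k by (simp add: sum.remove)
  also have "(\<Sum>j\<in>{..<s} - {k}. L $$ (k, j) * b $ j) = 0"
    using contr that by (intro sum.neutral) auto
  finally show False using diag b(2) by simp
qed

text \<open>A factor with exponent \<open>0\<close> equals \<open>1\<close> even where
  \<open>x\<close> vanishes, so only arcs of the digraph can make the product zero.\<close>

lemma gcb_prod_eq_0_iff:
  fixes x :: "'k::field vec"
  assumes "gcb_matrix s L" "k < s"
  shows "(\<Prod>j\<in>{..<s} - {k}. x $ j ^ nat (- L $$ (k, j))) = 0 \<longleftrightarrow>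
    (\<exists>j<s. j \<noteq> k \<and> L $$ (k, j) \<noteq> 0 \<and> x $ j = 0)"
proof -
  have pow: "x $ j ^ nat (- L $$ (k, j)) = 0 \<longleftrightarrow> L $$ (k, j) \<noteq> 0 \<and> x $ j = 0"
    if "j < s" "j \<noteq> k" for j
  proof -
    have "L $$ (k, j) \<le> 0" using assms that by (auto simp: gcb_matrix_def)
    then show ?thesis by auto
  qed
  have "(\<Prod>j\<in>{..<s} - {k}. x $ j ^ nat (- L $$ (k, j))) = 0 \<longleftrightarrow>
      (\<exists>j\<in>{..<s} - {k}. x $ j ^ nat (- L $$ (k, j)) = 0)"
    by (intro prod_zero_iff) simp
  also have "\<dots> \<longleftrightarrow> (\<exists>j\<in>{..<s} - {k}. L $$ (k, j) \<noteq> 0 \<and> x $ j = 0)"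
    using pow by (intro bex_cong) auto
  finally show ?thesis by blast
qed

text \<open>The equation at \<open>k\<close> carries a zero at a successor of \<open>k\<close> back
  to \<open>k\<close>, so the zero set of a point is predecessor-closed, and it contains
  \<open>i\<close>.\<close>

lemma zero_locus_trivial_if_irreducible:
  assumes gcb: "gcb_matrix s L" and irr: "irreducible_mat s L" and i: "i < s"
  shows "zero_locus s (Idl\<^bsub>poly_ring s\<^esub> (insert (poly_var i) (matrix_ideal (transpose_mat L))))
    = {0\<^sub>v s :: 'k::field vec}"
proof -
  have diag: "nat (L $$ (k, k)) > 0" if "k < s" for k using gcb that by (auto simp: gcb_matrix_def)
  have "x = 0\<^sub>v s"
    if x: "x \<in> carrier_vec s" "x $ i = 0" and eq: "\<And>k. k < s \<Longrightarrow>
      x $ k ^ nat (L $$ (k, k)) = (\<Prod>j\<in>{..<s} - {k}. x $ j ^ nat (- L $$ (k, j)))"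
    for x :: "'k vec"
  proof -
    have "{k. k < s \<and> x $ k = 0} = {..<s}"
    proof (rule irreducible_matD[OF irr])
      show "{k. k < s \<and> x $ k = 0} \<noteq> {}" using x i by auto
      fix k j assume kj: "k < s" "j \<in> {k. k < s \<and> x $ k = 0}" "L $$ (k, j) \<noteq> 0"
      have "x $ k = 0"
      proof (cases "j = k")
        case False
        with kj have "(\<Prod>j\<in>{..<s} - {k}. x $ j ^ nat (- L $$ (k, j))) = 0"
          unfolding gcb_prod_eq_0_iff[OF gcb kj(1)] by auto
        with eq[OF kj(1)] show ?thesis by simp
      qed (use kj in auto)
      with kj show "k \<in> {k. k < s \<and> x $ k = 0}" by simp
    qed auto
    with x show ?thesis by (auto simp: vec_eq_iff)
  qed
  \<comment> \<open>The origin is a point: each row has a nonzero off-diagonal entry, so neither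
    monomial of its binomial is constant.\<close>
  moreover have "(0\<^sub>v s :: 'k vec) $ k ^ nat (L $$ (k, k)) =
      (\<Prod>j\<in>{..<s} - {k}. (0\<^sub>v s :: 'k vec) $ j ^ nat (- L $$ (k, j)))" if k: "k < s" for k
  proof -
    obtain j where "j < s" "j \<noteq> k" "L $$ (k, j) \<noteq> 0" using gcb_matrix_row_nonzero[OF gcb k] .
    then have "(\<Prod>j\<in>{..<s} - {k}. (0\<^sub>v s :: 'k vec) $ j ^ nat (- L $$ (k, j))) = 0"
      unfolding gcb_prod_eq_0_iff[OF gcb k] by auto
    moreover have "(0\<^sub>v s :: 'k vec) $ k ^ nat (L $$ (k, k)) = 0" using k diag[OF k] by simp
    ultimately show ?thesis by (simp only:)
  qed
  ultimately show ?thesis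
    using i by (auto simp: in_zero_locus_iff[OF gcb i])
qed

text \<open>A minimal set closed under predecessors has at least two elements, as every vertex has a
  predecessor other than itself, and each of its elements has a successor in it other than itself.
  Hence the vector vanishing exactly on this set satisfies all the binomial equations.\<close>

lemma irreducible_if_zero_locus_trivial:
  assumes gcb: "gcb_matrix s L"
    and triv: "\<And>i. i < s \<Longrightarrow>
      zero_locus s (Idl\<^bsub>poly_ring s\<^esub> (insert (poly_var i) (matrix_ideal (transpose_mat L))))
        = {0\<^sub>v s :: 'k::field vec}"
  shows "irreducible_mat s L"
proof (rule ccontr)
  assume "\<not> irreducible_mat s L"
  define closed where "closed = (\<lambda>Z. Z \<subset> {..<s} \<and> Z \<noteq> {} \<and>
    (\<forall>k<s. \<forall>j\<in>Z. L $$ (k, j) \<noteq> 0 \<longrightarrow> k \<in> Z))"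
  obtain Z0 where "closed Z0"
    using \<open>\<not> irreducible_mat s L\<close> by (elim not_irreducible_matE) (auto simp: closed_def)
  then obtain Z where Z: "closed Z" and min: "\<And>Y. closed Y \<Longrightarrow> card Z \<le> card Y"
    using ex_has_least_nat[of closed Z0 card] by blast
  then have sub: "Z \<subset> {..<s}" and pred: "\<And>k j. k < s \<Longrightarrow> j \<in> Z \<Longrightarrow> L $$ (k, j) \<noteq> 0 \<Longrightarrow> k \<in> Z"
    by (auto simp: closed_def)
  have fin: "finite Z" using sub finite_subset by blast
  have succ: "\<exists>j\<in>Z. j \<noteq> k \<and> L $$ (k, j) \<noteq> 0" if k: "k \<in> Z" for k
  proof (rule ccontr)
    assume no_succ: "\<not> (\<exists>j\<in>Z. j \<noteq> k \<and> L $$ (k, j) \<noteq> 0)"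
    have "k < s" using k sub by auto
    then obtain p where "p < s" "p \<noteq> k" "L $$ (p, k) \<noteq> 0" using gcb by (auto simp: gcb_matrix_def)
    with pred k have "p \<in> Z - {k}" by auto
    \<comment> \<open>\<open>k\<close> is not a predecessor of any other element of
      \<open>Z\<close>, so removing it keeps closure; \<open>p\<close> keeps the set
      nonempty.\<close>
    then have "closed (Z - {k})" using no_succ pred sub by (auto simp: closed_def)
    from min[OF this] show False using k fin by (meson card_Diff1_less not_le)
  qed
  define x :: "'k vec" where "x = vec s (\<lambda>i. if i \<in> Z then 0 else 1)"
  have x_ix: "x $ k = (if k \<in> Z then 0 else 1)" if "k < s" for k using that by (simp add: x_def)
  obtain i where i: "i \<in> Z" "i < s" using Z by (auto simp: closed_def)
  have "x \<in> zero_locus s (Idl\<^bsub>poly_ring s\<^esub> (insert (poly_var i) (matrix_ideal (transpose_mat L))))"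
    unfolding in_zero_locus_iff[OF gcb i(2)]
  proof (intro conjI allI impI)
    fix k assume k: "k < s"
    show "x $ k ^ nat (L $$ (k, k)) = (\<Prod>j\<in>{..<s} - {k}. x $ j ^ nat (- L $$ (k, j)))"
    proof (cases "k \<in> Z")
      case True
      then have "(\<Prod>j\<in>{..<s} - {k}. x $ j ^ nat (- L $$ (k, j))) = 0"
        unfolding gcb_prod_eq_0_iff[OF gcb k] using succ[OF True] sub x_ix by fastforce
      moreover have "x $ k ^ nat (L $$ (k, k)) = 0"
        using gcb k True by (simp add: gcb_matrix_def x_ix)
      ultimately show ?thesis by (simp only:)
    next
      case False
      \<comment> \<open>No arc leads from \<open>k\<close> into \<open>Z\<close>, so each zero
        coordinate has exponent \<open>0\<close> and its factor is \<open>1\<close>.\<close>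
      have "x $ j ^ nat (- L $$ (k, j)) = 1" if "j < s" for j
      proof (cases "j \<in> Z")
        case True
        with pred[OF k True] False have "L $$ (k, j) = 0" by blast
        then show ?thesis by simp
      qed (simp add: x_ix that)
      then have "(\<Prod>j\<in>{..<s} - {k}. x $ j ^ nat (- L $$ (k, j))) = 1"
        by (intro prod.neutral) auto
      moreover have "x $ k ^ nat (L $$ (k, k)) = 1" using False k by (simp add: x_ix)
      ultimately show ?thesis by (simp only:)
    qed
  qed (use i in \<open>auto simp: x_def\<close>)
  with triv[OF i(2)] have "x = 0\<^sub>v s" by simp
  moreover obtain r where "r < s" "r \<notin> Z" using sub by auto
  ultimately show False using x_ix[of r] by simp
qed

theorem proposition7p6:
  fixes s :: nat and L :: "int mat" and I :: "'k::field mvpoly set"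
  assumes "s \<ge> 1"
    and "gcb_matrix s L"
    and "I = matrix_ideal (transpose_mat L)"
  shows
    "(strongly_connected (with_proj (underlying_digraph L)) \<longleftrightarrow>
        (\<forall>i<s. zero_locus s (Idl\<^bsub>poly_ring s\<^esub> (insert (poly_var i) I)) = {0\<^sub>v s}))
     \<and>
     ((\<forall>i<s. zero_locus s (Idl\<^bsub>poly_ring s\<^esub> (insert (poly_var i) I)) = {0\<^sub>v s}) \<longleftrightarrow>
        (\<forall>i<s. \<forall>j<s. adj_mat L $$ (i, j) > 0))"
proof -
  have "L \<in> carrier_mat s s" using assms(2) by (simp add: gcb_matrix_def)
  then have "strongly_connected (with_proj (underlying_digraph L)) \<longleftrightarrow> irreducible_mat s L"
    using assms(1) by (intro strongly_connected_iff_irreducible_mat) auto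
  moreover have "irreducible_mat s L \<longleftrightarrow>
      (\<forall>i<s. zero_locus s (Idl\<^bsub>poly_ring s\<^esub> (insert (poly_var i) I)) = {0\<^sub>v s})"
    unfolding assms(3)
    using zero_locus_trivial_if_irreducible[OF assms(2), where 'k = 'k]
      irreducible_if_zero_locus_trivial[OF assms(2), where 'k = 'k] by blast
  moreover have "irreducible_mat s L \<longleftrightarrow> (\<forall>i<s. \<forall>j<s. adj_mat L $$ (i, j) > 0)"
    using gcb_matrix_adj_pos[OF assms(2)] gcb_matrix_irreducible_if_adj_pos[OF assms(2)] by blast
  ultimately show ?thesis by blast
qed

end
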